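(* Let $\mathbf{z}_t = \begin{bmatrix} x_t \\ y_t \end{bmatrix} \in \mathbb{R}^2$ ($t\in\mathbb{Z}$) be a stable bivariate VAR($p$) process, $p\ge 1$, $$\mathbf{z}_t = A_1 \mathbf{z}_{t-1} + \cdots + A_p \mathbf{z}_{t-p} + \epsilon_t, \qquad \Sigma = \langle \epsilon_t\epsilon_t^\top\rangle = \begin{bmatrix} \Sigma_{xx} & \Sigma_{xy} \\ \Sigma_{xy} & \Sigma_{yy}\end{bmatrix},$$ with time-reversed representation $$\mathbf{z}_t = \tilde{A}_1 \mathbf{z}_{t+1} + \cdots + \tilde{A}_p \mathbf{z}_{t+p} + \tilde{\epsilon}_t, \qquad \tilde{\Sigma} = \langle \tilde{\epsilon}_t\tilde{\epsilon}_t^\top\rangle = \begin{bmatrix} \tilde{\Sigma}_{xx} & \tilde{\Sigma}_{xy} \\ \tilde{\Sigma}_{xy} & \tilde{\Sigma}_{yy}\end{bmatrix},$$ where the residual variances $\Sigma_{xx},\Sigma_{yy}$ are positive (so that the Granger scores are defined). Assume that (A1) $A_1,\ldots,A_p$ are lower triangular matrices; (A2) $\Sigma$ is a diagonal matrix, i.e. $\Sigma_{xy}=0$; (A3) $C_{\mathbf{z}}(0)$ is invertible. Then the differences of Granger scores on original and time-reversed signals satisfy $$\tilde{D}_{y\to x} = F_{y\to x} - \tilde{F}_{\tilde{y}\to\tilde{x}} \leq 0,$$ $$\tilde{D}_{x\to y} = F_{x\to y} - \tilde{F}_{\tilde{x}\to\tilde{y}} \geq 0,$$ $$\tilde{D}^{(net)}_{x\to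 y} = (F_{x\to y} - F_{y\to x}) - (\tilde{F}_{\tilde{x}\to\tilde{y}} - \tilde{F}_{\tilde{y}\to\tilde{x}}) \geq 0.$$
   Context: $\langle\cdot\rangle$ denotes expectation. For a stationary process $\mathbf{z}_t$ the cross-covariance matrices are $C_{\mathbf{z}}(h) = \big\langle (\mathbf{z}_t - \langle \mathbf{z}\rangle)(\mathbf{z}_{t-h} - \langle\mathbf{z}\rangle)^\top\big\rangle$, $h\in\mathbb{Z}$. Stable VAR($p$) process: $A_1,\ldots,A_p\in\mathbb{R}^{2\times 2}$ satisfy $\det(I - A_1\lambda - \cdots - A_p\lambda^p)\neq 0$ for all $\lambda\in\mathbb{C}$ with $|\lambda|\le 1$, and $\mathbf{z}_t$ is the (second-order) stationary process satisfying the recursion. The innovations (residuals) $\epsilon_t\in\mathbb{R}^2$ are white noise: they form a stationary process with finite covariance, $\langle\epsilon_t\rangle=0$, $\langle\epsilon_t\epsilon_{t-h}^\top\rangle=0$ for all $h\in\mathbb{Z}\setminus\{0\}$, and moreover $\langle\epsilon_t\mathbf{z}_{t-h}^\top\rangle=0$ for all integers $h\ge 1$. Neither independence nor Gaussianity of the $\epsilon_t$ is assumed. Time-reversed representation: the time-reversed process $\tilde{\mathbf{z}}_t := \mathbf{z}_{-t}$ has again a VAR($p$) representation (a known result of Andel), written as $\mathbf{z}_t = \tilde{A}_1 \mathbf{z}_{t+1} + \cdots + \tilde{A}_p \mathbf{z}_{t+p} + \tilde{\epsilon}_t$, where $\tilde{\epsilon}_t$ is white noise (mean zero, $\langle\tilde{\epsilon}_t\tilde{\epsilon}_{t-h}^\top\rangle=0$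 for $h\in\mathbb{Z}\setminus\{0\}$) with $\langle\tilde{\epsilon}_t\mathbf{z}_{t+h}^\top\rangle=0$ for all integers $h\ge 1$; its residual covariance matrix is $\tilde{\Sigma}=\langle\tilde{\epsilon}_t\tilde{\epsilon}_t^\top\rangle$. Restricted (univariate) models: $x_t$ and $y_t$ have autoregressive representations $x_t = \sum_{k=1}^\infty a_k x_{t-k} + \xi^x_t$ and $y_t = \sum_{k=1}^\infty b_k y_{t-k} + \xi^y_t$ with serially uncorrelated residuals of variances $\Sigma_x := \mathrm{Var}(\xi^x_t)$ and $\Sigma_y := \mathrm{Var}(\xi^y_t)$ (i.e. the variances of the error of the best linear prediction of $x_t$, resp. $y_t$, from its own past). Likewise, in reversed time, $x_t = \sum_{k=1}^\infty a_k x_{t+k} + \tilde{\xi}^x_t$ and $y_t = \sum_{k=1}^\infty b_k y_{t+k} + \tilde{\xi}^y_t$ with the same coefficients, and $\tilde{\Sigma}_x := \mathrm{Var}(\tilde{\xi}^x_t)$, $\tilde{\Sigma}_y := \mathrm{Var}(\tilde{\xi}^y_t)$ (the variances of the error of best linear prediction from the variable's own future); one has $\tilde{\Sigma}_x=\Sigma_x$ and $\tilde{\Sigma}_y=\Sigma_y$ because the autocovariance function of a univariate stationary series is symmetric. Granger scores: $F_{y\to x} := \log(\Sigma_x/\Sigma_{xx})$, $F_{x\to y} := \log(\Sigma_y/\Sigma_{yy})$. Time-reversed Granger scores: $\tilde{F}_{\tilde{y}\to\tilde{x}} := \log(\tilde{\Sigma}_x/\tilde{\Sigma}_{xx})$,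 $\tilde{F}_{\tilde{x}\to\tilde{y}} := \log(\tilde{\Sigma}_y/\tilde{\Sigma}_{yy})$. The differences $\tilde{D}_{y\to x}$, $\tilde{D}_{x\to y}$, $\tilde{D}^{(net)}_{x\to y}$ are defined by the expressions displayed in the claim. *)

theory Defs
  imports "HOL-Probability.Probability"
begin

text \<open>
  A process is a family of random vectors indexed by \<^typ>\<open>int\<close>. Stationarity is meant in the
  wide (second-order) sense throughout; neither independence nor any distribution is assumed.
\<close>

definition square_integrable :: "'a measure \<Rightarrow> ('a \<Rightarrow> real ^ 'n) \<Rightarrow> bool" where
  "square_integrable M U \<longleftrightarrow>
     U \<in> borel_measurable M \<and> integrable M (\<lambda>\<omega>. (norm (U \<omega>))\<^sup>2)"

definition cross_moment ::
  "'a measure \<Rightarrow> ('a \<Rightarrow> real ^ 'n) \<Rightarrow> ('a \<Rightarrow> real ^ 'm) \<Rightarrow> real ^ 'm ^ 'n" where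
  "cross_moment M U V = (\<chi> i j. \<integral>\<omega>. U \<omega> $ i * V \<omega> $ j \<partial>M)"

definition cross_cov ::
  "'a measure \<Rightarrow> ('a \<Rightarrow> real ^ 'n) \<Rightarrow> ('a \<Rightarrow> real ^ 'm) \<Rightarrow> real ^ 'm ^ 'n" where
  "cross_cov M U V =
     cross_moment M (\<lambda>\<omega>. U \<omega> - (\<integral>\<omega>'. U \<omega>' \<partial>M)) (\<lambda>\<omega>. V \<omega> - (\<integral>\<omega>'. V \<omega>' \<partial>M))"

definition stationary :: "'a measure \<Rightarrow> (int \<Rightarrow> 'a \<Rightarrow> real ^ 'n) \<Rightarrow> bool" where
  "stationary M Z \<longleftrightarrow>
     (\<forall>t. square_integrable M (Z t)) \<and>
     (\<forall>t. (\<integral>\<omega>. Z t \<omega> \<partial>M) = (\<integral>\<omega>. Z 0 \<omega> \<partial>M)) \<and>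
     (\<forall>t h. cross_cov M (Z t) (Z (t - h)) = cross_cov M (Z 0) (Z (- h)))"

text \<open>For stationary processes the choice of the time point 0 is immaterial here and in
  \<open>residual_cov\<close>, \<open>residual_var\<close> below.\<close>

definition autocov :: "'a measure \<Rightarrow> (int \<Rightarrow> 'a \<Rightarrow> real ^ 'n) \<Rightarrow> int \<Rightarrow> real ^ 'n ^ 'n" where
  "autocov M Z h = cross_cov M (Z 0) (Z (- h))"

definition residual_cov :: "'a measure \<Rightarrow> (int \<Rightarrow> 'a \<Rightarrow> real ^ 'n) \<Rightarrow> real ^ 'n ^ 'n" where
  "residual_cov M \<epsilon> = cross_moment M (\<epsilon> 0) (\<epsilon> 0)"

definition residual_var :: "'a measure \<Rightarrow> (int \<Rightarrow> 'a \<Rightarrow> real) \<Rightarrow> real" where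
  "residual_var M \<xi> = prob_space.variance M (\<xi> 0)"

definition white_noise :: "'a measure \<Rightarrow> (int \<Rightarrow> 'a \<Rightarrow> real ^ 'n) \<Rightarrow> bool" where
  "white_noise M \<epsilon> \<longleftrightarrow>
     stationary M \<epsilon> \<and>
     (\<forall>t. (\<integral>\<omega>. \<epsilon> t \<omega> \<partial>M) = 0) \<and>
     (\<forall>t h. h \<noteq> 0 \<longrightarrow> cross_moment M (\<epsilon> t) (\<epsilon> (t - h)) = 0)"

text \<open>Only the coefficients \<open>A 1, \<dots>, A p\<close> are relevant.\<close>

definition stable_VAR :: "nat \<Rightarrow> (nat \<Rightarrow> real ^ 'n ^ 'n) \<Rightarrow> bool" where
  "stable_VAR p A \<longleftrightarrow>
     (\<forall>z::complex. norm z \<le> 1 \<longrightarrow>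
        det (mat 1 - (\<Sum>k=1..p. \<chi> i j. complex_of_real (A k $ i $ j) * z ^ k)) \<noteq> 0)"

definition VAR_representation ::
  "'a measure \<Rightarrow> nat \<Rightarrow> (nat \<Rightarrow> real ^ 'n ^ 'n) \<Rightarrow> (int \<Rightarrow> 'a \<Rightarrow> real ^ 'n) \<Rightarrow>
     (int \<Rightarrow> 'a \<Rightarrow> real ^ 'n) \<Rightarrow> bool" where
  "VAR_representation M p A Z \<epsilon> \<longleftrightarrow>
     (\<forall>t. AE \<omega> in M. Z t \<omega> = (\<Sum>k=1..p. A k *v Z (t - int k) \<omega>) + \<epsilon> t \<omega>) \<and>
     white_noise M \<epsilon> \<and>
     (\<forall>t h. h \<ge> 1 \<longrightarrow> cross_moment M (\<epsilon> t) (Z (t - h)) = 0)"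

text \<open>
  A scalar process \<open>X\<close> with an infinite-order autoregressive representation: the series
  \<open>\<Sum>k\<ge>1. a k * X (t - k)\<close> converges to \<open>X t - \<xi> t\<close> in mean square, and \<open>\<xi> t\<close> is the error of the
  best linear prediction of \<open>X t\<close> from its own past. The optimality clause is not redundant:
  white residuals alone do not determine the residual variance (for a stationary AR(1) process
  with coefficient 1/2, the process \<open>X t - 2 * X (t - 1)\<close> is white noise too, with four times the
  variance). It is enough to compare with predictors using finitely many lags.
\<close>

definition AR_representation ::
  "'a measure \<Rightarrow> (nat \<Rightarrow> real) \<Rightarrow> (int \<Rightarrow> 'a \<Rightarrow> real) \<Rightarrow> (int \<Rightarrow> 'a \<Rightarrow> real) \<Rightarrow> bool" where
  "AR_representation M a X \<xi> \<longleftrightarrow>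
     (\<forall>t. (\<lambda>n. \<integral>\<omega>. (X t \<omega> - (\<Sum>k=1..n. a k * X (t - int k) \<omega>) - \<xi> t \<omega>)\<^sup>2 \<partial>M) \<longlonglongrightarrow> 0) \<and>
     white_noise M (\<lambda>t \<omega>. vec (\<xi> t \<omega>) :: real ^ 1) \<and>
     (\<forall>t n c. (\<integral>\<omega>. (\<xi> t \<omega>)\<^sup>2 \<partial>M)
        \<le> (\<integral>\<omega>. (X t \<omega> - (\<Sum>k=1..n. c k * X (t - int k) \<omega>))\<^sup>2 \<partial>M))"

definition coordinate :: "'n \<Rightarrow> (int \<Rightarrow> 'a \<Rightarrow> real ^ 'n) \<Rightarrow> int \<Rightarrow> 'a \<Rightarrow> real" where
  "coordinate i Z t \<omega> = Z t \<omega> $ i"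

definition time_reversed :: "(int \<Rightarrow> 'b) \<Rightarrow> int \<Rightarrow> 'b" where
  "time_reversed Z t = Z (- t)"

text \<open>
  Representations in reversed time are obtained by reversing both the process and the residuals;
  the two lemmas below spell out what this means in terms of the original time index.
\<close>

lemma all_uminus_int: "(\<forall>t::int. P (- t)) \<longleftrightarrow> (\<forall>t. P t)"
  by (metis minus_minus)

lemma VAR_representation_time_reversed:
  "VAR_representation M p A (time_reversed Z) (time_reversed \<epsilon>) \<longleftrightarrow>
     (\<forall>t. AE \<omega> in M. Z t \<omega> = (\<Sum>k=1..p. A k *v Z (t + int k) \<omega>) + \<epsilon> t \<omega>) \<and>
     white_noise M (time_reversed \<epsilon>) \<and>
     (\<forall>t h. h \<ge> 1 \<longrightarrow> cross_moment M (\<epsilon> t) (Z (t + h)) = 0)"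
proof -
  have "(\<forall>t. AE \<omega> in M. Z (- t) \<omega> = (\<Sum>k=1..p. A k *v Z (- t + int k) \<omega>) + \<epsilon> (- t) \<omega>) \<longleftrightarrow>
        (\<forall>t. AE \<omega> in M. Z t \<omega> = (\<Sum>k=1..p. A k *v Z (t + int k) \<omega>) + \<epsilon> t \<omega>)"
    by (rule all_uminus_int)
  moreover have "(\<forall>t h. h \<ge> 1 \<longrightarrow> cross_moment M (\<epsilon> (- t)) (Z (- t + h)) = 0) \<longleftrightarrow>
        (\<forall>t h. h \<ge> 1 \<longrightarrow> cross_moment M (\<epsilon> t) (Z (t + h)) = 0)"
    by (rule all_uminus_int)
  ultimately show ?thesis
    unfolding VAR_representation_def time_reversed_def by simp
qed

lemma AR_representation_time_reversed:
  "AR_representation M a (time_reversed X) (time_reversed \<xi>) \<longleftrightarrow>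
     (\<forall>t. (\<lambda>n. \<integral>\<omega>. (X t \<omega> - (\<Sum>k=1..n. a k * X (t + int k) \<omega>) - \<xi> t \<omega>)\<^sup>2 \<partial>M) \<longlonglongrightarrow> 0) \<and>
     white_noise M (time_reversed (\<lambda>t \<omega>. vec (\<xi> t \<omega>) :: real ^ 1)) \<and>
     (\<forall>t n c. (\<integral>\<omega>. (\<xi> t \<omega>)\<^sup>2 \<partial>M)
        \<le> (\<integral>\<omega>. (X t \<omega> - (\<Sum>k=1..n. c k * X (t + int k) \<omega>))\<^sup>2 \<partial>M))"
proof -
  have "(\<forall>t. (\<lambda>n. \<integral>\<omega>. (X (- t) \<omega> - (\<Sum>k=1..n. a k * X (- t + int k) \<omega>) - \<xi> (- t) \<omega>)\<^sup>2 \<partial>M)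
           \<longlonglongrightarrow> 0) \<longleftrightarrow>
        (\<forall>t. (\<lambda>n. \<integral>\<omega>. (X t \<omega> - (\<Sum>k=1..n. a k * X (t + int k) \<omega>) - \<xi> t \<omega>)\<^sup>2 \<partial>M) \<longlonglongrightarrow> 0)"
    by (rule all_uminus_int)
  moreover have "(\<forall>t n c. (\<integral>\<omega>. (\<xi> (- t) \<omega>)\<^sup>2 \<partial>M)
        \<le> (\<integral>\<omega>. (X (- t) \<omega> - (\<Sum>k=1..n. c k * X (- t + int k) \<omega>))\<^sup>2 \<partial>M)) \<longleftrightarrow>
        (\<forall>t n c. (\<integral>\<omega>. (\<xi> t \<omega>)\<^sup>2 \<partial>M)
        \<le> (\<integral>\<omega>. (X t \<omega> - (\<Sum>k=1..n. c k * X (t + int k) \<omega>))\<^sup>2 \<partial>M))"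
    by (rule all_uminus_int)
  ultimately show ?thesis
    unfolding AR_representation_def time_reversed_def by simp
qed

text \<open>
  Row and column 1 belong to the first coordinate, row and column 2 to the second. The order of
  the index type \<^typ>\<open>2\<close> cannot be used to express this, since \<open>(2 :: 2) = 0\<close>.
\<close>

definition lower_triangular2 :: "real ^ 2 ^ 2 \<Rightarrow> bool" where
  "lower_triangular2 B \<longleftrightarrow> B $ 1 $ 2 = 0"

definition diagonal_matrix :: "real ^ 'n ^ 'n \<Rightarrow> bool" where
  "diagonal_matrix B \<longleftrightarrow> (\<forall>i j. i \<noteq> j \<longrightarrow> B $ i $ j = 0)"

definition granger_score :: "real \<Rightarrow> real \<Rightarrow> real" where
  "granger_score restricted_var full_var = ln (restricted_var / full_var)"

end

theory Submission
  imports Defs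
begin

text \<open>
  Write \<open>S\<close> and \<open>S'\<close> for the residual covariance matrices of the forward and the time-reversed
  autoregression of \<open>z\<close>, and \<open>s x\<close>, \<open>s y\<close> for the residual variances of the univariate
  autoregressions. The latter do not change under time reversal, because the autocovariance of a
  scalar stationary series is symmetric (\<open>AR_residual_var_time_reversed\<close>). They cancel in the
  differences of Granger scores, which become

  \<^item> \<open>D_yx = ln (S' x x) - ln (S x x)\<close>,
  \<^item> \<open>D_xy = ln (S' y y) - ln (S y y)\<close>.

  So it has to be shown that \<open>S' x x \<le> S x x\<close> and \<open>S y y \<le> S' y y\<close>; the net difference is
  \<open>D_xy - D_yx\<close>. Splitting the logarithms of the quotients requires all variances to be positive. For
  \<open>s x\<close> and \<open>s y\<close> this holds because they are at least \<open>S x x\<close> and \<open>S y y\<close>, for \<open>S' x x\<close> and \<open>S' y y\<close>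
  because their product is at least \<open>det S' = det S > 0\<close>.

  The first inequality expresses that \<open>y\<close> does not Granger-cause \<open>x\<close>. As the coefficients are lower
  triangular, the first row of the forward recursion predicts \<open>x\<close> from its own past alone, hence
  \<open>s x \<le> S x x\<close> (\<open>residual_var_le_residual_cov\<close>). In reversed time, predicting \<open>x\<close> from the future
  of both coordinates is at least as good as predicting it from its own future, hence \<open>S' x x \<le> s x\<close>
  (\<open>residual_cov_le_residual_var\<close>).

  The second inequality follows from the first and the invariance \<open>det S' = det S\<close> of the generalized
  residual variance (\<open>det_residual_cov_time_reversed\<close>): as \<open>S\<close> is diagonal,
  \<open>S x x * S y y = det S = det S' \<le> S' x x * S' y y \<le> S x x * S' y y\<close>.

  The invariance of the determinant is obtained from the Gram determinants \<open>G n\<close> of all coordinates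
  of \<open>n\<close> consecutive observations. A Gram determinant is the product of the successive prediction
  errors in any enumeration of its vectors (\<open>gram_cong_set\<close>). Appending one more time point to at
  least \<open>p\<close> earlier ones multiplies it by \<open>det S\<close> (\<open>block_gram_VAR_step\<close>). As \<open>G n\<close> depends only on
  second moments, stationarity makes it the same for the reversed process, and
  \<open>det S * G p = G (p + 1) = det S' * G p\<close> with \<open>G p > 0\<close>.
\<close>

section \<open>Square-integrable random variables and their second moments\<close>

definition L2 :: "'a measure \<Rightarrow> ('a \<Rightarrow> real) set" where
  "L2 M = {f \<in> borel_measurable M. integrable M (\<lambda>\<omega>. (f \<omega>)\<^sup>2)}"

definition moment :: "'a measure \<Rightarrow> ('a \<Rightarrow> real) \<Rightarrow> ('a \<Rightarrow> real) \<Rightarrow> real" where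
  "moment M f g = (\<integral>\<omega>. f \<omega> * g \<omega> \<partial>M)"

lemma L2_measurable: "f \<in> L2 M \<Longrightarrow> f \<in> borel_measurable M"
  by (simp add: L2_def)

lemma L2_integrable_mult:
  assumes f: "f \<in> L2 M" and g: "g \<in> L2 M"
  shows "integrable M (\<lambda>\<omega>. f \<omega> * g \<omega>)"
proof (rule Bochner_Integration.integrable_bound)
  show "integrable M (\<lambda>\<omega>. (f \<omega>)\<^sup>2 + (g \<omega>)\<^sup>2)"
    using f g by (simp add: L2_def)
  show "(\<lambda>\<omega>. f \<omega> * g \<omega>) \<in> borel_measurable M"
    using f g by (auto simp: L2_def)
  have "\<bar>x * y\<bar> \<le> x\<^sup>2 + y\<^sup>2" for x y :: real
  proof -
    have "2 * (\<bar>x\<bar> * \<bar>y\<bar>) \<le> x\<^sup>2 + y\<^sup>2"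
      using sum_squares_bound[of "\<bar>x\<bar>" "\<bar>y\<bar>"] by simp
    moreover have "0 \<le> \<bar>x\<bar> * \<bar>y\<bar>" by simp
    ultimately show ?thesis
      unfolding abs_mult by linarith
  qed
  then show "AE \<omega> in M. norm (f \<omega> * g \<omega>) \<le> norm ((f \<omega>)\<^sup>2 + (g \<omega>)\<^sup>2)"
    by simp
qed

lemma L2_scale: "f \<in> L2 M \<Longrightarrow> (\<lambda>\<omega>. c * f \<omega>) \<in> L2 M"
  by (auto simp: L2_def power_mult_distrib)

lemma L2_zero: "(\<lambda>\<omega>. 0) \<in> L2 M"
  by (simp add: L2_def)

lemma L2_add:
  assumes "f \<in> L2 M" "g \<in> L2 M" shows "(\<lambda>\<omega>. f \<omega> + g \<omega>) \<in> L2 M"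
  using assms L2_integrable_mult[OF assms]
  by (auto simp: L2_def power2_sum mult.assoc)

lemma L2_diff:
  assumes "f \<in> L2 M" "g \<in> L2 M" shows "(\<lambda>\<omega>. f \<omega> - g \<omega>) \<in> L2 M"
  using L2_add[OF assms(1) L2_scale[OF assms(2), of "-1"]] by simp

lemma L2_sum:
  assumes "\<And>j. j \<in> S \<Longrightarrow> v j \<in> L2 M" shows "(\<lambda>\<omega>. \<Sum>j\<in>S. c j * v j \<omega>) \<in> L2 M"
  using assms by (induction S rule: infinite_finite_induct) (auto intro: L2_zero L2_add[OF L2_scale])

lemma moment_commute: "moment M f g = moment M g f"
  by (simp add: moment_def mult.commute)

lemma moment_self: "moment M f f = (\<integral>\<omega>. (f \<omega>)\<^sup>2 \<partial>M)"
  by (simp add: moment_def power2_eq_square)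

lemma moment_self_nonneg: "0 \<le> moment M f f"
  by (simp add: moment_self)

lemma moment_scale_left: "moment M (\<lambda>\<omega>. c * f \<omega>) g = c * moment M f g"
  by (simp add: moment_def mult.assoc)

lemma moment_scale_right: "moment M f (\<lambda>\<omega>. c * g \<omega>) = c * moment M f g"
  by (simp add: moment_def mult.left_commute)

lemma moment_diff_left:
  assumes "f \<in> L2 M" "g \<in> L2 M" "h \<in> L2 M"
  shows "moment M (\<lambda>\<omega>. f \<omega> - g \<omega>) h = moment M f h - moment M g h"
  using assms by (simp add: moment_def left_diff_distrib L2_integrable_mult)

lemma moment_diff_right:
  assumes "f \<in> L2 M" "g \<in> L2 M" "h \<in> L2 M"
  shows "moment M h (\<lambda>\<omega>. f \<omega> - g \<omega>) = moment M h f - moment M h g"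
  using assms by (simp add: moment_commute[of M h] moment_diff_left)

lemma moment_sum_left:
  assumes "\<And>j. j \<in> S \<Longrightarrow> v j \<in> L2 M" "g \<in> L2 M"
  shows "moment M (\<lambda>\<omega>. \<Sum>j\<in>S. c j * v j \<omega>) g = (\<Sum>j\<in>S. c j * moment M (v j) g)"
proof -
  have "moment M (\<lambda>\<omega>. \<Sum>j\<in>S. c j * v j \<omega>) g = (\<integral>\<omega>. (\<Sum>j\<in>S. c j * (v j \<omega> * g \<omega>)) \<partial>M)"
    by (simp add: moment_def sum_distrib_right mult.assoc)
  also have "\<dots> = (\<Sum>j\<in>S. \<integral>\<omega>. c j * (v j \<omega> * g \<omega>) \<partial>M)"
    using assms by (intro Bochner_Integration.integral_sum) (auto intro: L2_integrable_mult)
  finally show ?thesis by (simp add: moment_def)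
qed

lemma moment_sum_right:
  assumes "\<And>j. j \<in> S \<Longrightarrow> v j \<in> L2 M" "g \<in> L2 M"
  shows "moment M g (\<lambda>\<omega>. \<Sum>j\<in>S. c j * v j \<omega>) = (\<Sum>j\<in>S. c j * moment M g (v j))"
  using moment_sum_left[OF assms] by (simp add: moment_commute)

lemma moment_cong_AE:
  assumes "f \<in> L2 M" "f' \<in> L2 M" "g \<in> L2 M" "g' \<in> L2 M"
    and "AE \<omega> in M. f \<omega> = f' \<omega>" and "AE \<omega> in M. g \<omega> = g' \<omega>"
  shows "moment M f g = moment M f' g'"
  unfolding moment_def using assms
  by (intro integral_cong_AE borel_measurable_times L2_measurable) auto

lemma moment_self_diff:
  assumes "f \<in> L2 M" "g \<in> L2 M"
  shows "moment M (\<lambda>\<omega>. f \<omega> - g \<omega>) (\<lambda>\<omega>. f \<omega> - g \<omega>)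
    = moment M f f - 2 * moment M f g + moment M g g"
  using assms by (simp add: moment_diff_left moment_diff_right L2_diff moment_commute[of M g f])

lemma moment_Cauchy_Schwarz:
  assumes f: "f \<in> L2 M" and g: "g \<in> L2 M"
  shows "(moment M f g)\<^sup>2 \<le> moment M f f * moment M g g"
proof -
  have quad: "0 \<le> moment M f f - 2 * t * moment M f g + t\<^sup>2 * moment M g g" for t
    using moment_self_nonneg[of M "\<lambda>\<omega>. f \<omega> - t * g \<omega>"] moment_self_diff[OF f L2_scale[OF g, of t]]
    by (simp add: moment_scale_left moment_scale_right power2_eq_square mult.assoc)
  show ?thesis
  proof (cases "moment M g g = 0")
    case True
    have "moment M f g = 0"
    proof (rule ccontr)
      assume nz: "moment M f g \<noteq> 0"
      show False
        \<comment> \<open>The quadratic form is affine in \<open>t\<close> here; at this \<open>t\<close> it takes the value \<open>-1\<close>.\<close>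
        using quad[of "(moment M f f + 1) / (2 * moment M f g)"] True nz by simp
    qed
    then show ?thesis using True by simp
  next
    case False
    then have pos: "0 < moment M g g"
      using moment_self_nonneg[of M g] by linarith
    \<comment> \<open>The quadratic form at its minimum.\<close>
    have "0 \<le> moment M g g * (moment M f f - 2 * (moment M f g / moment M g g) * moment M f g
        + (moment M f g / moment M g g)\<^sup>2 * moment M g g)"
      using quad[of "moment M f g / moment M g g"] pos by (intro mult_nonneg_nonneg) auto
    also have "\<dots> = moment M f f * moment M g g - (moment M f g)\<^sup>2"
      using pos by (simp add: field_simps power2_eq_square)
    finally show ?thesis by simp
  qed
qed

lemma moment_eq_0_if_null:
  assumes "f \<in> L2 M" "g \<in> L2 M" "moment M f f = 0 \<or> moment M g g = 0"
  shows "moment M f g = 0"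
  using moment_Cauchy_Schwarz[OF assms(1,2)] assms(3) by auto

section \<open>Linear prediction from finitely many random variables\<close>

text \<open>
  The variable \<open>r\<close> is what remains of \<open>u\<close> after orthogonal projection onto the span of \<open>v j\<close>, \<open>j \<in> S\<close>.
  Equality almost everywhere is all that an autoregressive recursion provides.
\<close>

definition is_residual ::
  "'a measure \<Rightarrow> ('i \<Rightarrow> 'a \<Rightarrow> real) \<Rightarrow> 'i set \<Rightarrow> ('a \<Rightarrow> real) \<Rightarrow> ('a \<Rightarrow> real) \<Rightarrow> bool" where
  "is_residual M v S u r \<longleftrightarrow> r \<in> L2 M \<and>
     (\<exists>c. AE \<omega> in M. r \<omega> = u \<omega> - (\<Sum>j\<in>S. c j * v j \<omega>)) \<and>
     (\<forall>j\<in>S. moment M r (v j) = 0)"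

definition prediction_error ::
  "'a measure \<Rightarrow> ('i \<Rightarrow> 'a \<Rightarrow> real) \<Rightarrow> 'i set \<Rightarrow> 'i \<Rightarrow> real" where
  "prediction_error M v S i =
     (INF c. \<integral>\<omega>. (v i \<omega> - (\<Sum>j\<in>S. c j * v j \<omega>))\<^sup>2 \<partial>M)"

lemma is_residual_orthogonal_sum:
  assumes "is_residual M v S u r" "\<And>j. j \<in> S \<Longrightarrow> v j \<in> L2 M"
  shows "moment M r (\<lambda>\<omega>. \<Sum>j\<in>S. c j * v j \<omega>) = 0"
  using assms by (simp add: is_residual_def moment_sum_right)

text \<open>
  Pythagoras: any prediction differs from the orthogonal projection by an element of the span, which
  is orthogonal to the residual and so only adds to the mean square error.
\<close>

lemma is_residual_le:
  assumes v: "\<And>j. j \<in> S \<Longrightarrow> v j \<in> L2 M" and u: "u \<in> L2 M"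
    and r: "is_residual M v S u r"
  shows "moment M r r \<le> (\<integral>\<omega>. (u \<omega> - (\<Sum>j\<in>S. c j * v j \<omega>))\<^sup>2 \<partial>M)"
proof -
  obtain d where d: "AE \<omega> in M. r \<omega> = u \<omega> - (\<Sum>j\<in>S. d j * v j \<omega>)" and rL: "r \<in> L2 M"
    using r by (auto simp: is_residual_def)
  define q where "q = (\<lambda>\<omega>. \<Sum>j\<in>S. (c j - d j) * v j \<omega>)"
  have qL: "q \<in> L2 M"
    unfolding q_def using v by (rule L2_sum)
  have cL: "(\<lambda>\<omega>. u \<omega> - (\<Sum>j\<in>S. c j * v j \<omega>)) \<in> L2 M"
    using u v by (intro L2_diff L2_sum)
  have ae: "AE \<omega> in M. u \<omega> - (\<Sum>j\<in>S. c j * v j \<omega>) = r \<omega> - q \<omega>"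
    using d by eventually_elim (simp add: q_def left_diff_distrib sum_subtractf)
  have "(\<integral>\<omega>. (u \<omega> - (\<Sum>j\<in>S. c j * v j \<omega>))\<^sup>2 \<partial>M)
      = moment M (\<lambda>\<omega>. r \<omega> - q \<omega>) (\<lambda>\<omega>. r \<omega> - q \<omega>)"
    unfolding moment_self[symmetric] using cL L2_diff[OF rL qL] ae by (intro moment_cong_AE)
  also have "\<dots> = moment M r r + moment M q q"
    using is_residual_orthogonal_sum[OF r v] rL qL by (simp add: moment_self_diff q_def)
  finally show ?thesis
    using moment_self_nonneg[of M q] by simp
qed

lemma prediction_error_eq:
  assumes v: "\<And>j. j \<in> S \<Longrightarrow> v j \<in> L2 M" and u: "v i \<in> L2 M"
    and r: "is_residual M v S (v i) r"
  shows "prediction_error M v S i = moment M r r"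
proof -
  obtain d where d: "AE \<omega> in M. r \<omega> = v i \<omega> - (\<Sum>j\<in>S. d j * v j \<omega>)" and rL: "r \<in> L2 M"
    using r by (auto simp: is_residual_def)
  have "(\<lambda>\<omega>. v i \<omega> - (\<Sum>j\<in>S. d j * v j \<omega>)) \<in> L2 M"
    using u v by (intro L2_diff L2_sum)
  then have att: "(\<integral>\<omega>. (v i \<omega> - (\<Sum>j\<in>S. d j * v j \<omega>))\<^sup>2 \<partial>M) = moment M r r"
    unfolding moment_self[symmetric] using d rL by (intro moment_cong_AE) auto
  show ?thesis
    unfolding prediction_error_def
  proof (rule antisym)
    show "(INF c. \<integral>\<omega>. (v i \<omega> - (\<Sum>j\<in>S. c j * v j \<omega>))\<^sup>2 \<partial>M) \<le> moment M r r"
      unfolding att[symmetric] by (rule cINF_lower) (auto intro: bdd_belowI[where m = 0])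
    show "moment M r r \<le> (INF c. \<integral>\<omega>. (v i \<omega> - (\<Sum>j\<in>S. c j * v j \<omega>))\<^sup>2 \<partial>M)"
      using is_residual_le[OF v u r] by (intro cINF_greatest) auto
  qed
qed

text \<open>
  One step of Gram-Schmidt orthogonalization: once \<open>S\<close> has been projected out, enlarging \<open>S\<close> by \<open>k\<close>
  only requires subtracting the component along the residual of \<open>v k\<close>.
\<close>

lemma is_residual_insert:
  assumes fin: "finite S" and k: "k \<notin> S"
    and v: "\<And>j. j \<in> S \<Longrightarrow> v j \<in> L2 M" and vk: "v k \<in> L2 M"
    and u: "u \<in> L2 M"
    and ru: "is_residual M v S u r" and rk: "is_residual M v S (v k) s"
  shows "is_residual M v (insert k S) u (\<lambda>\<omega>. r \<omega> - (moment M r s / moment M s s) * s \<omega>)"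
proof -
  define \<alpha> where "\<alpha> = moment M r s / moment M s s"
  obtain c where c: "AE \<omega> in M. r \<omega> = u \<omega> - (\<Sum>j\<in>S. c j * v j \<omega>)" and rL: "r \<in> L2 M"
    using ru by (auto simp: is_residual_def)
  obtain d where d: "AE \<omega> in M. s \<omega> = v k \<omega> - (\<Sum>j\<in>S. d j * v j \<omega>)" and sL: "s \<in> L2 M"
    using rk by (auto simp: is_residual_def)
  have tL: "(\<lambda>\<omega>. r \<omega> - \<alpha> * s \<omega>) \<in> L2 M"
    using rL sL by (intro L2_diff L2_scale)
  have ae: "AE \<omega> in M. r \<omega> - \<alpha> * s \<omega> = u \<omega> -
      (\<Sum>j\<in>insert k S. (if j = k then \<alpha> else c j - \<alpha> * d j) * v j \<omega>)"
    using c d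
  proof eventually_elim
    case (elim \<omega>)
    have "(\<Sum>j\<in>S. (if j = k then \<alpha> else c j - \<alpha> * d j) * v j \<omega>)
        = (\<Sum>j\<in>S. c j * v j \<omega> - \<alpha> * (d j * v j \<omega>))"
      using k by (intro sum.cong) (auto simp: algebra_simps)
    also have "\<dots> = (\<Sum>j\<in>S. c j * v j \<omega>) - \<alpha> * (\<Sum>j\<in>S. d j * v j \<omega>)"
      by (simp add: sum_subtractf sum_distrib_left)
    finally have "(\<Sum>j\<in>insert k S. (if j = k then \<alpha> else c j - \<alpha> * d j) * v j \<omega>)
        = \<alpha> * v k \<omega> + ((\<Sum>j\<in>S. c j * v j \<omega>) - \<alpha> * (\<Sum>j\<in>S. d j * v j \<omega>))"
      using fin k by simp
    then show ?case
      unfolding elim by (simp add: right_diff_distrib)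
  qed
  have orthS: "moment M (\<lambda>\<omega>. r \<omega> - \<alpha> * s \<omega>) (v j) = 0" if "j \<in> S" for j
    using that ru rk v rL sL
    by (simp add: is_residual_def moment_diff_left L2_scale moment_scale_left)
  \<comment> \<open>When \<open>s\<close> is null the coefficient is \<open>0 / 0 = 0\<close>, and \<open>moment M r s\<close> vanishes as well.\<close>
  have "moment M r s = \<alpha> * moment M s s"
    using moment_eq_0_if_null[OF rL sL] by (cases "moment M s s = 0") (simp_all add: \<alpha>_def)
  then have "moment M (\<lambda>\<omega>. r \<omega> - \<alpha> * s \<omega>) s = 0"
    using rL sL by (simp add: moment_diff_left L2_scale moment_scale_left)
  moreover have "moment M (\<lambda>\<omega>. r \<omega> - \<alpha> * s \<omega>) s
      = moment M (\<lambda>\<omega>. r \<omega> - \<alpha> * s \<omega>) (\<lambda>\<omega>. v k \<omega> - (\<Sum>j\<in>S. d j * v j \<omega>))"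
    using tL sL d L2_diff[OF vk L2_sum[of S v, OF v]] by (intro moment_cong_AE) auto
  ultimately have "moment M (\<lambda>\<omega>. r \<omega> - \<alpha> * s \<omega>) (v k) = 0"
    using tL vk v orthS by (simp add: moment_diff_right L2_sum moment_sum_right)
  then show ?thesis
    using tL orthS unfolding is_residual_def \<alpha>_def[symmetric]
    by (intro conjI exI[where x = "\<lambda>j. if j = k then \<alpha> else c j - \<alpha> * d j"] ae) auto
qed

lemma is_residual_exists:
  assumes "finite S" and "\<And>j. j \<in> S \<Longrightarrow> v j \<in> L2 M" and "u \<in> L2 M"
  shows "\<exists>r. is_residual M v S u r"
  using assms
proof (induction S arbitrary: u rule: finite_induct)
  case empty
  then show ?case by (auto simp: is_residual_def)
next
  case (insert k S)
  have v: "v j \<in> L2 M" if "j \<in> S" for j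
    using insert.prems(1) that by simp
  have vk: "v k \<in> L2 M"
    using insert.prems(1) by simp
  obtain r where r: "is_residual M v S u r"
    using insert.IH[OF v insert.prems(2)] by blast
  obtain s where s: "is_residual M v S (v k) s"
    using insert.IH[OF v vk] by blast
  show ?case
    using is_residual_insert[OF insert.hyps v vk insert.prems(2) r s] by blast
qed

lemma prediction_error_nonneg: "0 \<le> prediction_error M v S i"
  unfolding prediction_error_def by (rule cINF_greatest) auto

lemma prediction_error_antimono:
  assumes "finite T" "S \<subseteq> T" "\<And>j. j \<in> T \<Longrightarrow> v j \<in> L2 M" "v i \<in> L2 M"
  shows "prediction_error M v T i \<le> prediction_error M v S i"
proof -
  obtain r where r: "is_residual M v T (v i) r"
    using is_residual_exists assms(1,3,4) by blast
  have "moment M r r \<le> (\<integral>\<omega>. (v i \<omega> - (\<Sum>j\<in>S. c j * v j \<omega>))\<^sup>2 \<partial>M)" for c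
  proof -
    have "(\<Sum>j\<in>T. (if j \<in> S then c j else 0) * v j \<omega>) = (\<Sum>j\<in>S. c j * v j \<omega>)" for \<omega>
      using assms(1,2) by (intro sum.mono_neutral_cong_right) auto
    then show ?thesis
      using is_residual_le[OF assms(3,4) r, of "\<lambda>j. if j \<in> S then c j else 0"] by simp
  qed
  then have "moment M r r \<le> prediction_error M v S i"
    unfolding prediction_error_def by (intro cINF_greatest) auto
  then show ?thesis
    using prediction_error_eq[OF assms(3,4) r] by simp
qed

text \<open>
  Both sides are the Gram determinant of the two residuals, the left one computed by orthogonalizing
  \<open>s\<close> against \<open>r\<close>. The right-hand side is symmetric, which makes the order of the two predictions
  irrelevant; and when \<open>r\<close> and \<open>s\<close> are the innovations of a bivariate autoregression, it is the
  determinant of their covariance matrix.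
\<close>

lemma prediction_error_pair:
  assumes fin: "finite S" and i: "i \<notin> S"
    and v: "\<And>j. j \<in> S \<Longrightarrow> v j \<in> L2 M" and vi: "v i \<in> L2 M" and vj: "v j \<in> L2 M"
    and r: "is_residual M v S (v i) r" and s: "is_residual M v S (v j) s"
  shows "prediction_error M v S i * prediction_error M v (insert i S) j
    = moment M r r * moment M s s - (moment M r s)\<^sup>2"
proof -
  have rL: "r \<in> L2 M" and sL: "s \<in> L2 M"
    using r s by (auto simp: is_residual_def)
  have "is_residual M v (insert i S) (v j) (\<lambda>\<omega>. s \<omega> - (moment M s r / moment M r r) * r \<omega>)"
    using fin i v vi vj s r by (rule is_residual_insert)
  then have "prediction_error M v (insert i S) j
      = moment M (\<lambda>\<omega>. s \<omega> - (moment M s r / moment M r r) * r \<omega>)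
          (\<lambda>\<omega>. s \<omega> - (moment M s r / moment M r r) * r \<omega>)"
    using v vi vj by (intro prediction_error_eq) auto
  also have "\<dots> = moment M s s
      - 2 * (moment M s r / moment M r r) * moment M s r
      + (moment M s r / moment M r r)\<^sup>2 * moment M r r"
    by (simp only: moment_self_diff[OF sL L2_scale[OF rL]] moment_scale_left moment_scale_right)
      (simp add: power2_eq_square mult.assoc)
  finally have e: "prediction_error M v (insert i S) j = \<dots>" .
  have "prediction_error M v S i = moment M r r"
    using v vi r by (rule prediction_error_eq)
  then show ?thesis
    using e moment_eq_0_if_null[OF rL sL]
    by (cases "moment M r r = 0")
      (auto simp: field_simps power2_eq_square moment_commute[of M s r])
qed

lemma prediction_error_exchange:
  assumes fin: "finite S" and "i \<notin> S" "j \<notin> S"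
    and v: "\<And>k. k \<in> insert i (insert j S) \<Longrightarrow> v k \<in> L2 M"
  shows "prediction_error M v S i * prediction_error M v (insert i S) j
    = prediction_error M v S j * prediction_error M v (insert j S) i"
proof -
  have vS: "v k \<in> L2 M" if "k \<in> S" for k
    using v that by simp
  have vi: "v i \<in> L2 M" and vj: "v j \<in> L2 M"
    using v by simp_all
  obtain r where r: "is_residual M v S (v i) r"
    using is_residual_exists[where v = v, OF fin vS vi] by blast
  obtain s where s: "is_residual M v S (v j) s"
    using is_residual_exists[where v = v, OF fin vS vj] by blast
  show ?thesis
    using prediction_error_pair[where v = v, OF fin \<open>i \<notin> S\<close> vS vi vj r s]
      prediction_error_pair[where v = v, OF fin \<open>j \<notin> S\<close> vS vj vi s r]
    by (simp add: moment_commute[of M s r] mult.commute)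
qed

section \<open>Gram determinants\<close>

text \<open>
  The Gram determinant in its form as a product of squared distances, each vector being compared with
  the span of those listed after it. This form avoids matrices of variable size, and its factors are
  the quantities of interest.
\<close>

fun gram :: "'a measure \<Rightarrow> ('i \<Rightarrow> 'a \<Rightarrow> real) \<Rightarrow> 'i list \<Rightarrow> real" where
  "gram M v [] = 1"
| "gram M v (i # xs) = prediction_error M v (set xs) i * gram M v xs"

text \<open>
  Moving an element to the front is a sequence of exchanges of neighbours, and each of them preserves
  the product by \<open>prediction_error_exchange\<close>.
\<close>

lemma gram_rotate:
  assumes "distinct (xs @ i # ys)" "\<And>k. k \<in> set (xs @ i # ys) \<Longrightarrow> v k \<in> L2 M"
  shows "gram M v (xs @ i # ys) = gram M v (i # xs @ ys)"
  using assms
proof (induction xs)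
  case (Cons x xs)
  have "prediction_error M v (set (xs @ ys)) i * prediction_error M v (insert i (set (xs @ ys))) x
    = prediction_error M v (set (xs @ ys)) x * prediction_error M v (insert x (set (xs @ ys))) i"
    using Cons.prems by (intro prediction_error_exchange) auto
  moreover have "gram M v (xs @ i # ys) = gram M v (i # xs @ ys)"
    by (rule Cons.IH) (use Cons.prems in auto)
  ultimately show ?case
    by (simp add: mult.assoc[symmetric]) (simp add: mult.commute)
qed simp

lemma gram_cong_set:
  assumes "distinct xs" "distinct ys" "set xs = set ys" "\<And>k. k \<in> set xs \<Longrightarrow> v k \<in> L2 M"
  shows "gram M v xs = gram M v ys"
  using assms
proof (induction xs arbitrary: ys)
  case (Cons x xs)
  obtain us ws where ys: "ys = us @ x # ws"
    using Cons.prems(3) by (metis list.set_intros(1) split_list)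
  have "set xs = set (us @ ws)"
    using Cons.prems(1-3) unfolding ys by auto
  moreover from this have "gram M v xs = gram M v (us @ ws)"
    using Cons.prems unfolding ys by (intro Cons.IH) auto
  moreover have "gram M v ys = gram M v (x # us @ ws)"
    unfolding ys using Cons.prems unfolding ys by (intro gram_rotate) auto
  ultimately show ?case by simp
qed simp

text \<open>
  The mean square error of a linear predictor is a quadratic polynomial in its coefficients whose own
  coefficients are second moments. Two families with the same second moments therefore have the same
  prediction errors and Gram determinants, which is how stationarity enters.
\<close>

lemma mean_square_error_expand:
  assumes v: "\<And>j. j \<in> insert i S \<Longrightarrow> v j \<in> L2 M"
  shows "(\<integral>\<omega>. (v i \<omega> - (\<Sum>j\<in>S. c j * v j \<omega>))\<^sup>2 \<partial>M)
    = moment M (v i) (v i) - 2 * (\<Sum>j\<in>S. c j * moment M (v i) (v j))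
      + (\<Sum>j\<in>S. c j * (\<Sum>k\<in>S. c k * moment M (v j) (v k)))"
  using v unfolding moment_self[symmetric]
  by (simp add: moment_self_diff L2_sum moment_sum_left moment_sum_right)

lemma prediction_error_reindex:
  assumes inj: "inj_on f S"
    and v: "\<And>j. j \<in> insert (f i) (f ` S) \<Longrightarrow> v j \<in> L2 M"
    and w: "\<And>j. j \<in> insert i S \<Longrightarrow> w j \<in> L2 M"
    and eq: "\<And>j k. j \<in> insert i S \<Longrightarrow> k \<in> insert i S \<Longrightarrow>
      moment M (w j) (w k) = moment M (v (f j)) (v (f k))"
  shows "prediction_error M w S i = prediction_error M v (f ` S) (f i)"
proof -
  let ?Q = "\<lambda>c. \<integral>\<omega>. (w i \<omega> - (\<Sum>j\<in>S. c j * w j \<omega>))\<^sup>2 \<partial>M"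
  let ?R = "\<lambda>c. \<integral>\<omega>. (v (f i) \<omega> - (\<Sum>j\<in>f ` S. c j * v j \<omega>))\<^sup>2 \<partial>M"
  have QR: "?Q (\<lambda>j. c (f j)) = ?R c" for c
  proof -
    have "?Q (\<lambda>j. c (f j)) = moment M (v (f i)) (v (f i))
        - 2 * (\<Sum>j\<in>S. c (f j) * moment M (v (f i)) (v (f j)))
        + (\<Sum>j\<in>S. c (f j) * (\<Sum>k\<in>S. c (f k) * moment M (v (f j)) (v (f k))))"
      using mean_square_error_expand[where v = w and c = "\<lambda>j. c (f j)" and i = i and S = S, OF w]
      by (simp add: eq cong: sum.cong)
    also have "\<dots> = ?R c"
      using mean_square_error_expand[where v = v and c = c and i = "f i" and S = "f ` S", OF v]
      by (simp add: sum.reindex[OF inj])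
    finally show ?thesis .
  qed
  have RQ: "?Q c = ?R (\<lambda>j. c (inv_into S f j))" for c
    using QR[of "\<lambda>j. c (inv_into S f j)"] inj by (simp cong: sum.cong)
  have "range ?Q = range ?R"
  proof (rule antisym)
    show "range ?Q \<subseteq> range ?R"
      by (rule image_subsetI) (subst RQ, rule rangeI)
    show "range ?R \<subseteq> range ?Q"
      by (rule image_subsetI) (subst QR[symmetric], rule rangeI)
  qed
  then show ?thesis
    unfolding prediction_error_def by simp
qed

lemma gram_reindex:
  assumes "inj_on f (set xs)"
    and "\<And>j. j \<in> f ` set xs \<Longrightarrow> v j \<in> L2 M"
    and "\<And>j. j \<in> set xs \<Longrightarrow> w j \<in> L2 M"
    and "\<And>j k. j \<in> set xs \<Longrightarrow> k \<in> set xs \<Longrightarrow>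
      moment M (w j) (w k) = moment M (v (f j)) (v (f k))"
  shows "gram M w xs = gram M v (map f xs)"
  using assms
proof (induction xs)
  case (Cons x xs)
  have "prediction_error M w (set xs) x = prediction_error M v (f ` set xs) (f x)"
    using Cons.prems by (intro prediction_error_reindex) (auto simp: inj_on_def)
  moreover have "gram M w xs = gram M v (map f xs)"
    using Cons.prems by (intro Cons.IH) (auto simp: inj_on_def)
  ultimately show ?case by simp
qed simp

section \<open>Second moments of stationary processes\<close>

text \<open>
  The coordinates of a vector-valued process at all times, as one family of scalar variables, so that
  a predictor may use any finite set of pairs of a time and a coordinate.
\<close>

definition observation :: "(int \<Rightarrow> 'a \<Rightarrow> real ^ 'n) \<Rightarrow> int \<times> 'n \<Rightarrow> 'a \<Rightarrow> real" where
  "observation Z = (\<lambda>(t, i) \<omega>. Z t \<omega> $ i)"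

lemma observation_Pair: "observation Z (t, i) = (\<lambda>\<omega>. Z t \<omega> $ i)"
  by (simp add: observation_def)

lemma square_integrable_component:
  assumes "square_integrable M U"
  shows "(\<lambda>\<omega>. U \<omega> $ i) \<in> L2 M"
proof -
  have meas: "(\<lambda>\<omega>. U \<omega> $ i) \<in> borel_measurable M"
    using assms borel_measurable_continuous_on[OF linear_continuous_on[OF bounded_linear_vec_nth]]
    unfolding square_integrable_def by blast
  moreover have "integrable M (\<lambda>\<omega>. (U \<omega> $ i)\<^sup>2)"
  proof (rule Bochner_Integration.integrable_bound)
    show "integrable M (\<lambda>\<omega>. (norm (U \<omega>))\<^sup>2)"
      using assms by (simp add: square_integrable_def)
    show "(\<lambda>\<omega>. (U \<omega> $ i)\<^sup>2) \<in> borel_measurable M"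
      using meas by (rule borel_measurable_power)
    have "(x $ i)\<^sup>2 \<le> (norm x)\<^sup>2" for x :: "real ^ 'b"
      using power_mono[OF component_le_norm_cart[of x i], of 2] by simp
    then show "AE \<omega> in M. norm ((U \<omega> $ i)\<^sup>2) \<le> norm ((norm (U \<omega>))\<^sup>2)"
      by simp
  qed
  ultimately show ?thesis by (simp add: L2_def)
qed

lemma observation_L2:
  "(\<And>t. square_integrable M (Z t)) \<Longrightarrow> observation Z q \<in> L2 M"
  using square_integrable_component[of M "Z (fst q)" "snd q"]
  by (cases q) (simp add: observation_Pair)

lemma cross_moment_nth:
  "cross_moment M U V $ i $ j = moment M (\<lambda>\<omega>. U \<omega> $ i) (\<lambda>\<omega>. V \<omega> $ j)"
  by (simp add: cross_moment_def moment_def)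

lemma (in prob_space) integral_component:
  assumes "square_integrable M U"
  shows "(\<integral>\<omega>. U \<omega> \<partial>M) $ i = expectation (\<lambda>\<omega>. U \<omega> $ i)"
    and "integrable M (\<lambda>\<omega>. U \<omega> $ i)"
proof -
  have "integrable M U"
  proof (rule Bochner_Integration.integrable_bound)
    show "integrable M (\<lambda>\<omega>. 1 + (norm (U \<omega>))\<^sup>2)"
      using assms by (simp add: square_integrable_def)
    show "U \<in> borel_measurable M"
      using assms by (simp add: square_integrable_def)
    have "y \<le> 1 + y\<^sup>2" for y :: real
      using sum_squares_bound[of 1 y] by (simp, smt (verit) zero_le_power2)
    then show "AE \<omega> in M. norm (U \<omega>) \<le> norm (1 + (norm (U \<omega>))\<^sup>2)"
      by simp
  qed
  then show "(\<integral>\<omega>. U \<omega> \<partial>M) $ i = expectation (\<lambda>\<omega>. U \<omega> $ i)"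
    and "integrable M (\<lambda>\<omega>. U \<omega> $ i)"
    using integral_bounded_linear[OF bounded_linear_vec_nth, of M U i]
      integrable_bounded_linear[OF bounded_linear_vec_nth, of M U i] by simp_all
qed

text \<open>
  Stationarity is a statement about centred covariances and a constant mean, whereas the projections
  above use uncentred second moments; this identity translates between the two.
\<close>

lemma (in prob_space) moment_eq_cross_cov:
  assumes "square_integrable M U" "square_integrable M V"
  shows "moment M (\<lambda>\<omega>. U \<omega> $ i) (\<lambda>\<omega>. V \<omega> $ j)
    = cross_cov M U V $ i $ j + (\<integral>\<omega>. U \<omega> \<partial>M) $ i * (\<integral>\<omega>. V \<omega> \<partial>M) $ j"
proof -
  let ?u = "(\<integral>\<omega>. U \<omega> \<partial>M) $ i" and ?v = "(\<integral>\<omega>. V \<omega> \<partial>M) $ j"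
  have "cross_cov M U V $ i $ j
      = expectation (\<lambda>\<omega>. U \<omega> $ i * V \<omega> $ j - ?u * V \<omega> $ j - ?v * U \<omega> $ i + ?u * ?v)"
    unfolding cross_cov_def cross_moment_def by (simp add: algebra_simps)
  also have "\<dots> = expectation (\<lambda>\<omega>. U \<omega> $ i * V \<omega> $ j) - ?u * ?v - ?v * ?u + ?u * ?v"
    using integral_component[OF assms(1)] integral_component[OF assms(2)]
      L2_integrable_mult[OF assms[THEN square_integrable_component]]
    by (simp add: prob_space)
  finally show ?thesis
    by (simp add: moment_def)
qed

lemma (in prob_space) stationary_moment_shift:
  assumes "stationary M Z"
  shows "moment M (observation Z (s + h, i)) (observation Z (t + h, j))
    = moment M (observation Z (s, i)) (observation Z (t, j))"
proof -
  have sq: "square_integrable M (Z t)" for t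
    using assms by (simp add: stationary_def)
  have mean: "(\<integral>\<omega>. Z t \<omega> \<partial>M) = (\<integral>\<omega>. Z 0 \<omega> \<partial>M)" for t
    using assms by (simp add: stationary_def)
  have cov: "cross_cov M (Z t) (Z (t - d)) = cross_cov M (Z 0) (Z (- d))" for t d
    using assms by (simp add: stationary_def)
  have "cross_cov M (Z (s + h)) (Z (t + h)) = cross_cov M (Z s) (Z t)"
    using cov[of "s + h" "s - t"] cov[of s "s - t"] by (simp add: algebra_simps)
  then show ?thesis
    by (simp add: observation_Pair moment_eq_cross_cov[OF sq sq]
        mean[of "s + h"] mean[of "t + h"] mean[of s] mean[of t])
qed

lemma white_noise_moment:
  assumes "white_noise M \<epsilon>"
  shows "moment M (\<lambda>\<omega>. \<epsilon> t \<omega> $ i) (\<lambda>\<omega>. \<epsilon> t \<omega> $ j) = residual_cov M \<epsilon> $ i $ j"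
proof -
  have mean: "(\<integral>\<omega>. \<epsilon> t \<omega> \<partial>M) = 0" for t
    using assms by (simp add: white_noise_def)
  have "cross_cov M (\<epsilon> t) (\<epsilon> (t - 0)) = cross_cov M (\<epsilon> 0) (\<epsilon> (- 0))"
    using assms unfolding white_noise_def stationary_def by blast
  then have "cross_moment M (\<epsilon> t) (\<epsilon> t) = cross_moment M (\<epsilon> 0) (\<epsilon> 0)"
    by (simp add: cross_cov_def mean)
  then show ?thesis
    by (simp add: residual_cov_def flip: cross_moment_nth)
qed

section \<open>Innovations of a vector autoregression\<close>

text \<open>
  Autoregressive recursions are sums over lags, while predictors are linear combinations over a set of
  pairs of a time and a coordinate; this identity converts the former into the latter, the pairs
  outside the \<open>n\<close> most recent times getting coefficient \<open>0\<close>.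
\<close>

lemma lagged_sum:
  fixes w :: "int \<times> 'n::finite \<Rightarrow> real"
  assumes "finite S" and "{t - int n..<t} \<times> UNIV \<subseteq> S"
  shows "(\<Sum>k=1..n. \<Sum>j\<in>UNIV. c k j * w (t - int k, j))
    = (\<Sum>q\<in>S. (if fst q \<in> {t - int n..<t} then c (nat (t - fst q)) (snd q) else 0) * w q)"
proof -
  have "(\<Sum>k=1..n. \<Sum>j\<in>UNIV. c k j * w (t - int k, j))
      = (\<Sum>(k, j)\<in>{1..n} \<times> UNIV. c k j * w (t - int k, j))"
    by (simp add: sum.cartesian_product)
  also have "\<dots> = (\<Sum>q\<in>{t - int n..<t} \<times> UNIV. c (nat (t - fst q)) (snd q) * w q)"
    by (rule sum.reindex_bij_witness[where i = "\<lambda>q. (nat (t - fst q), snd q)"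
          and j = "\<lambda>(k, j). (t - int k, j)"]) auto
  also have "\<dots> = (\<Sum>q\<in>S. (if fst q \<in> {t - int n..<t} then c (nat (t - fst q)) (snd q) else 0) * w q)"
    using assms by (intro sum.mono_neutral_cong_left) auto
  finally show ?thesis .
qed

text \<open>
  The innovation is orthogonal to the entire past, so it remains the projection residual when the
  predictor uses more than the last \<open>p\<close> time points.
\<close>

lemma VAR_innovation_is_residual:
  fixes Z :: "int \<Rightarrow> 'a \<Rightarrow> real ^ 'n"
  assumes VAR: "VAR_representation M p A Z \<epsilon>"
    and fin: "finite S" and past: "{t - int p..<t} \<times> UNIV \<subseteq> S" "S \<subseteq> {..<t} \<times> UNIV"
  shows "is_residual M (observation Z) S (observation Z (t, i)) (\<lambda>\<omega>. \<epsilon> t \<omega> $ i)"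
  unfolding is_residual_def
proof (intro conjI ballI)
  have "square_integrable M (\<epsilon> t)"
    using VAR by (simp add: VAR_representation_def white_noise_def stationary_def)
  then show "(\<lambda>\<omega>. \<epsilon> t \<omega> $ i) \<in> L2 M"
    by (rule square_integrable_component)
next
  define c where "c = (\<lambda>q. if fst q \<in> {t - int p..<t} then A (nat (t - fst q)) $ i $ snd q else 0)"
  have "AE \<omega> in M. Z t \<omega> = (\<Sum>k=1..p. A k *v Z (t - int k) \<omega>) + \<epsilon> t \<omega>"
    using VAR by (simp add: VAR_representation_def)
  then have "AE \<omega> in M. \<epsilon> t \<omega> $ i = observation Z (t, i) \<omega> - (\<Sum>q\<in>S. c q * observation Z q \<omega>)"
  proof eventually_elim
    case (elim \<omega>)
    have "(\<Sum>q\<in>S. c q * observation Z q \<omega>)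
        = (\<Sum>k=1..p. \<Sum>j\<in>UNIV. A k $ i $ j * Z (t - int k) \<omega> $ j)"
      using lagged_sum[OF fin past(1), where w = "\<lambda>q. observation Z q \<omega>"
          and c = "\<lambda>k j. A k $ i $ j"]
      by (simp add: c_def observation_Pair)
    also have "\<dots> = (\<Sum>k=1..p. A k *v Z (t - int k) \<omega>) $ i"
      by (simp add: matrix_vector_mult_def)
    finally show ?case
      using elim by (simp add: observation_Pair)
  qed
  then show "\<exists>c. AE \<omega> in M. \<epsilon> t \<omega> $ i
      = observation Z (t, i) \<omega> - (\<Sum>q\<in>S. c q * observation Z q \<omega>)"
    by blast
next
  fix q assume "q \<in> S"
  then obtain s j where q: "q = (s, j)" and "s < t"
    using past(2) by (cases q) auto
  have "cross_moment M (\<epsilon> t) (Z (t - (t - s))) = 0"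
    using VAR \<open>s < t\<close> unfolding VAR_representation_def by (metis add_le_imp_le_diff add.commute zless_imp_add1_zle)
  then have "cross_moment M (\<epsilon> t) (Z s) $ i $ j = 0"
    by simp
  then show "moment M (\<lambda>\<omega>. \<epsilon> t \<omega> $ i) (observation Z q) = 0"
    unfolding q cross_moment_nth by (simp add: observation_Pair )
qed

lemma VAR_prediction_error_pair:
  fixes Z :: "int \<Rightarrow> 'a \<Rightarrow> real ^ 2"
  assumes VAR: "VAR_representation M p A Z \<epsilon>" and sq: "\<And>t. square_integrable M (Z t)"
    and fin: "finite S" and past: "{t - int p..<t} \<times> UNIV \<subseteq> S" "S \<subseteq> {..<t} \<times> UNIV"
  shows "prediction_error M (observation Z) S (t, 1)
      * prediction_error M (observation Z) (insert (t, 1) S) (t, 2) = det (residual_cov M \<epsilon>)"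
proof -
  have noise: "white_noise M \<epsilon>"
    using VAR by (simp add: VAR_representation_def)
  have sym: "residual_cov M \<epsilon> $ 2 $ 1 = residual_cov M \<epsilon> $ 1 $ 2"
    by (simp add: residual_cov_def cross_moment_nth moment_commute)
  have "(t, 1) \<notin> S"
    using past(2) by auto
  then show ?thesis
    using prediction_error_pair[where v = "observation Z", OF fin _ _ _ _
        VAR_innovation_is_residual[OF VAR fin past] VAR_innovation_is_residual[OF VAR fin past],
        of 1 2]
    by (simp add: observation_L2[OF sq] white_noise_moment[OF noise] det_2 power2_eq_square sym)
qed

section \<open>Invariance of the generalized residual variance under time reversal\<close>

text \<open>
  The Gram determinant of \<open>n\<close> consecutive observations of a bivariate process, that is, the
  determinant of a block Toeplitz matrix of size \<open>2 * n\<close> when the process is stationary.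
\<close>

definition block_gram :: "'a measure \<Rightarrow> (int \<Rightarrow> 'a \<Rightarrow> real ^ 2) \<Rightarrow> nat \<Rightarrow> real" where
  "block_gram M Z n = gram M (observation Z) (List.product [1..int n] [1, 2])"

lemma block_gram_eq:
  assumes "\<And>t. square_integrable M (Z t)" and "distinct xs" and "set xs = {1..int n} \<times> UNIV"
  shows "gram M (observation Z) xs = block_gram M Z n"
  unfolding block_gram_def
  using assms by (intro gram_cong_set) (auto intro: observation_L2 distinct_product simp: UNIV_2)

lemma block_gram_Suc:
  fixes Z :: "int \<Rightarrow> 'a \<Rightarrow> real ^ 2"
  assumes sq: "\<And>t. square_integrable M (Z t)"
  defines "t n \<equiv> int n + 1"
  shows "block_gram M Z (Suc n) = prediction_error M (observation Z) ({1..int n} \<times> UNIV) (t n, 1)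
    * prediction_error M (observation Z) (insert (t n, 1) ({1..int n} \<times> UNIV)) (t n, 2)
    * block_gram M Z n"
proof -
  let ?past = "List.product [1..int n] [1, 2::2]"
  have set: "set ?past = {1..int n} \<times> UNIV"
    by (auto simp: UNIV_2)
  have "gram M (observation Z) ((t n, 2) # (t n, 1) # ?past) = block_gram M Z (Suc n)"
    by (rule block_gram_eq[OF sq])
      (auto simp: t_def UNIV_2 intro: distinct_product)
  then show ?thesis
    by (simp add: set block_gram_def mult_ac del: set_product)
qed

text \<open>
  The reversed block \<open>Z (-1), \<dots>, Z (-n)\<close> becomes the block \<open>Z n, \<dots>, Z 1\<close> after a shift by
  \<open>n + 1\<close>; only the enumeration differs from the original one.
\<close>

lemma (in prob_space) block_gram_time_reversed:
  fixes Z :: "int \<Rightarrow> 'a \<Rightarrow> real ^ 2"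
  assumes st: "stationary M Z"
  shows "block_gram M (time_reversed Z) n = block_gram M Z n"
proof -
  have sq: "square_integrable M (Z t)" for t
    using st by (simp add: stationary_def)
  let ?xs = "List.product [1..int n] [1, 2::2]"
  define f :: "int \<times> 2 \<Rightarrow> int \<times> 2" where "f = (\<lambda>(t, i). (int n + 1 - t, i))"
  have inj: "inj_on f A" for A
    by (auto simp: f_def inj_on_def)
  have "block_gram M (time_reversed Z) n = gram M (observation Z) (map f ?xs)"
    unfolding block_gram_def
  proof (rule gram_reindex)
    fix j k
    show "moment M (observation (time_reversed Z) j) (observation (time_reversed Z) k)
        = moment M (observation Z (f j)) (observation Z (f k))"
      using stationary_moment_shift[OF st, of "- fst j" "int n + 1" "snd j" "- fst k" "snd k"]
      by (cases j; cases k) (simp add: f_def observation_Pair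
          time_reversed_def add.commute)
  qed (auto intro!: inj observation_L2 sq simp: time_reversed_def)
  also have "\<dots> = block_gram M Z n"
  proof (rule block_gram_eq[OF sq])
    show "distinct (map f ?xs)"
      by (auto simp: distinct_map inj intro: distinct_product)
    have "f ` ({1..int n} \<times> UNIV) = {1..int n} \<times> UNIV"
      by (auto simp: f_def image_iff Bex_def) presburger
    then show "set (map f ?xs) = {1..int n} \<times> UNIV"
      by (simp add: UNIV_2)
  qed
  finally show ?thesis .
qed

lemma block_gram_VAR_step:
  fixes Z :: "int \<Rightarrow> 'a \<Rightarrow> real ^ 2"
  assumes "VAR_representation M p A Z \<epsilon>" and "\<And>t. square_integrable M (Z t)" and "p \<le> n"
  shows "block_gram M Z (Suc n) = det (residual_cov M \<epsilon>) * block_gram M Z n"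
  using VAR_prediction_error_pair[OF assms(1,2), of "{1..int n} \<times> UNIV" "int n + 1"] assms(3)
  by (subst block_gram_Suc[OF assms(2)]) (auto simp: subset_iff)

text \<open>
  Blocks shorter than \<open>p\<close> are covered because prediction from fewer observations is never better: the
  two factors by which \<open>block_gram\<close> grows are at least those for a past of length \<open>max n p\<close>, whose
  product is \<open>det (residual_cov M \<epsilon>)\<close>.
\<close>

lemma block_gram_pos:
  fixes Z :: "int \<Rightarrow> 'a \<Rightarrow> real ^ 2"
  assumes VAR: "VAR_representation M p A Z \<epsilon>" and sq: "\<And>t. square_integrable M (Z t)"
    and pos: "0 < det (residual_cov M \<epsilon>)"
  shows "0 < block_gram M Z n"
proof (induction n)
  case 0
  show ?case by (simp add: block_gram_def)
next
  case (Suc n)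
  define t where "t = int n + 1"
  define N where "N = {1..int n} \<times> (UNIV :: 2 set)"
  define P where "P = {t - int (max n p)..<t} \<times> (UNIV :: 2 set)"
  let ?e = "prediction_error M (observation Z)"
  have fin: "finite P"
    by (simp add: P_def)
  have "?e P (t, 1) * ?e (insert (t, 1) P) (t, 2) = det (residual_cov M \<epsilon>)"
    by (rule VAR_prediction_error_pair[OF VAR sq fin]) (auto simp: P_def)
  then have "0 < ?e P (t, 1)" "0 < ?e (insert (t, 1) P) (t, 2)"
    using pos prediction_error_nonneg[of M "observation Z"]
    by (smt (verit, best) mult_nonneg_nonneg mult_eq_0_iff)+
  moreover have "N \<subseteq> P"
    by (auto simp: N_def P_def t_def)
  then have "?e P (t, 1) \<le> ?e N (t, 1)" "?e (insert (t, 1) P) (t, 2) \<le> ?e (insert (t, 1) N) (t, 2)"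
    using fin by (auto intro!: prediction_error_antimono observation_L2 sq)
  ultimately have "0 < ?e N (t, 1) * ?e (insert (t, 1) N) (t, 2)"
    by (intro mult_pos_pos) linarith+
  then show ?case
    using Suc.IH unfolding block_gram_Suc[OF sq] t_def N_def by simp
qed

text \<open>
  Both determinants are the factor by which the same positive Gram determinant grows from \<open>p\<close> to
  \<open>p + 1\<close> time points.
\<close>

lemma (in prob_space) det_residual_cov_time_reversed:
  fixes Z :: "int \<Rightarrow> 'a \<Rightarrow> real ^ 2"
  assumes st: "stationary M Z"
    and fwd: "VAR_representation M p A Z \<epsilon>"
    and bwd: "VAR_representation M p A' (time_reversed Z) (time_reversed \<epsilon>')"
    and pos: "0 < det (residual_cov M \<epsilon>)"
  shows "det (residual_cov M \<epsilon>') = det (residual_cov M \<epsilon>)"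
proof -
  have sq: "square_integrable M (Z t)" "square_integrable M (time_reversed Z t)" for t
    using st by (simp_all add: stationary_def time_reversed_def)
  have "residual_cov M (time_reversed \<epsilon>') = residual_cov M \<epsilon>'"
    by (simp add: residual_cov_def time_reversed_def)
  then have "det (residual_cov M \<epsilon>') * block_gram M Z p = det (residual_cov M \<epsilon>) * block_gram M Z p"
    using block_gram_VAR_step[OF fwd sq(1) order_refl] block_gram_VAR_step[OF bwd sq(2) order_refl]
    by (auto simp: block_gram_time_reversed[OF st])
  then show ?thesis
    using block_gram_pos[OF fwd sq(1) pos, of p] by auto
qed

section \<open>Univariate autoregressions of infinite order\<close>

lemma tendsto_moment_self:
  assumes w: "\<And>n. w n \<in> L2 M" and x: "x \<in> L2 M"
    and lim: "(\<lambda>n. \<integral>\<omega>. (w n \<omega> - x \<omega>)\<^sup>2 \<partial>M) \<longlonglongrightarrow> 0"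
  shows "(\<lambda>n. \<integral>\<omega>. (w n \<omega>)\<^sup>2 \<partial>M) \<longlonglongrightarrow> (\<integral>\<omega>. (x \<omega>)\<^sup>2 \<partial>M)"
proof -
  define d where "d = (\<lambda>n \<omega>. x \<omega> - w n \<omega>)"
  have dL: "d n \<in> L2 M" for n
    unfolding d_def using x w by (rule L2_diff)
  have dd: "(\<lambda>n. moment M (d n) (d n)) \<longlonglongrightarrow> 0"
    using lim by (simp add: moment_self d_def power2_commute)
  have "(\<lambda>n. sqrt (moment M x x * moment M (d n) (d n))) \<longlonglongrightarrow> sqrt (moment M x x * 0)"
    by (intro tendsto_real_sqrt tendsto_mult tendsto_const dd)
  then have "(\<lambda>n. sqrt (moment M x x * moment M (d n) (d n))) \<longlonglongrightarrow> 0"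
    by simp
  then have "(\<lambda>n. moment M x (d n)) \<longlonglongrightarrow> 0"
  proof (rule Lim_null_comparison[OF always_eventually, rotated])
    show "\<forall>n. norm (moment M x (d n)) \<le> sqrt (moment M x x * moment M (d n) (d n))"
      using moment_Cauchy_Schwarz[OF x dL] by (auto intro!: real_le_rsqrt)
  qed
  then have "(\<lambda>n. moment M x x - 2 * moment M x (d n) + moment M (d n) (d n))
      \<longlonglongrightarrow> moment M x x - 2 * 0 + 0"
    by (intro tendsto_intros dd)
  moreover have "(\<integral>\<omega>. (w n \<omega>)\<^sup>2 \<partial>M)
      = moment M x x - 2 * moment M x (d n) + moment M (d n) (d n)" for n
    unfolding moment_self_diff[OF x dL, symmetric] by (simp add: d_def moment_self)
  ultimately show ?thesis
    by (simp add: moment_self)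
qed

lemma (in prob_space) AR_residual_var:
  assumes "AR_representation M a X \<xi>"
  shows "residual_var M \<xi> = expectation (\<lambda>\<omega>. (\<xi> 0 \<omega>)\<^sup>2)"
    and "\<xi> t \<in> L2 M"
proof -
  have noise: "white_noise M (\<lambda>t \<omega>. vec (\<xi> t \<omega>) :: real ^ 1)"
    using assms by (simp add: AR_representation_def)
  then have sq: "square_integrable M (\<lambda>\<omega>. vec (\<xi> t \<omega>) :: real ^ 1)" for t
    by (simp add: white_noise_def stationary_def)
  show "\<xi> t \<in> L2 M"
    using square_integrable_component[OF sq, of t 1] by simp
  have "(\<integral>\<omega>. vec (\<xi> 0 \<omega>) \<partial>M) = (0 :: real ^ 1)"
    using noise by (simp add: white_noise_def)
  then have "expectation (\<xi> 0) = 0"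
    using integral_component(1)[OF sq, of 0 1] by simp
  then show "residual_var M \<xi> = expectation (\<lambda>\<omega>. (\<xi> 0 \<omega>)\<^sup>2)"
    by (simp add: residual_var_def)
qed

text \<open>
  Mean-square convergence of the autoregressive series lets every statement about the residual
  variance be reduced to predictors with finitely many lags.
\<close>

lemma (in prob_space) AR_mean_square_error_tendsto:
  assumes AR: "AR_representation M a X \<xi>" and X: "\<And>t. X t \<in> L2 M"
  shows "(\<lambda>n. expectation (\<lambda>\<omega>. (X 0 \<omega> - (\<Sum>k=1..n. a k * X (- int k) \<omega>))\<^sup>2))
    \<longlonglongrightarrow> residual_var M \<xi>"
  unfolding AR_residual_var(1)[OF AR]
proof (rule tendsto_moment_self)
  show "(\<lambda>\<omega>. X 0 \<omega> - (\<Sum>k=1..n. a k * X (- int k) \<omega>)) \<in> L2 M" for n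
    by (intro L2_diff L2_sum X)
  show "\<xi> 0 \<in> L2 M"
    by (rule AR_residual_var(2)[OF AR])
  have "(\<lambda>n. expectation (\<lambda>\<omega>. (X 0 \<omega> - (\<Sum>k=1..n. a k * X (0 - int k) \<omega>) - \<xi> 0 \<omega>)\<^sup>2)) \<longlonglongrightarrow> 0"
    using AR unfolding AR_representation_def by blast
  then show "(\<lambda>n. expectation (\<lambda>\<omega>. (X 0 \<omega> - (\<Sum>k=1..n. a k * X (- int k) \<omega>) - \<xi> 0 \<omega>)\<^sup>2)) \<longlonglongrightarrow> 0"
    by simp
qed

text \<open>
  The past of all coordinates contains the past of coordinate \<open>i\<close>, so each finite section of the
  univariate autoregression is one of the predictors that the vector innovation beats.
\<close>

lemma (in prob_space) residual_cov_le_residual_var: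
  fixes Z :: "int \<Rightarrow> 'a \<Rightarrow> real ^ 'n"
  assumes VAR: "VAR_representation M p A Z \<epsilon>" and sq: "\<And>t. square_integrable M (Z t)"
    and AR: "AR_representation M a (coordinate i Z) \<xi>"
  shows "residual_cov M \<epsilon> $ i $ i \<le> residual_var M \<xi>"
proof (rule Lim_bounded2)
  show "(\<lambda>n. expectation (\<lambda>\<omega>. (coordinate i Z 0 \<omega>
      - (\<Sum>k=1..n. a k * coordinate i Z (- int k) \<omega>))\<^sup>2)) \<longlonglongrightarrow> residual_var M \<xi>"
    using AR_mean_square_error_tendsto[OF AR] square_integrable_component[OF sq]
    by (simp add: coordinate_def[abs_def])
  show "\<forall>n\<ge>0. residual_cov M \<epsilon> $ i $ i \<le> expectation (\<lambda>\<omega>. (coordinate i Z 0 \<omega>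
      - (\<Sum>k=1..n. a k * coordinate i Z (- int k) \<omega>))\<^sup>2)"
  proof (intro allI impI)
    fix n :: nat
    define S where "S = {- int (max n p)..<0} \<times> (UNIV :: 'n set)"
    have fin: "finite S"
      by (simp add: S_def)
    have noise: "white_noise M \<epsilon>"
      using VAR by (simp add: VAR_representation_def)
    have res: "is_residual M (observation Z) S (observation Z (0, i)) (\<lambda>\<omega>. \<epsilon> 0 \<omega> $ i)"
      by (rule VAR_innovation_is_residual[OF VAR fin]) (auto simp: S_def)
    define c where "c = (\<lambda>q :: int \<times> 'n. if fst q \<in> {0 - int n..<0}
      then (if snd q = i then a (nat (0 - fst q)) else 0) else 0)"
    have "(\<Sum>q\<in>S. c q * observation Z q \<omega>) = (\<Sum>k=1..n. a k * coordinate i Z (- int k) \<omega>)" for \<omega>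
    proof -
      have "(\<Sum>q\<in>S. c q * observation Z q \<omega>)
          = (\<Sum>k=1..n. \<Sum>j\<in>UNIV. (if j = i then a k else 0) * observation Z (0 - int k, j) \<omega>)"
        unfolding c_def
        by (rule lagged_sum[OF fin, symmetric, where w = "\<lambda>q. observation Z q \<omega>"]) (auto simp: S_def)
      also have "\<dots> = (\<Sum>k=1..n. a k * coordinate i Z (- int k) \<omega>)"
        by (simp add: observation_Pair coordinate_def if_distrib[where f = "\<lambda>x. x * _"] cong: if_cong)
      finally show ?thesis .
    qed
    then show "residual_cov M \<epsilon> $ i $ i \<le> expectation (\<lambda>\<omega>. (coordinate i Z 0 \<omega>
        - (\<Sum>k=1..n. a k * coordinate i Z (- int k) \<omega>))\<^sup>2)"
      using is_residual_le[OF _ _ res, of c]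
      by (simp add: observation_L2[OF sq] white_noise_moment[OF noise])
        (simp add: observation_Pair coordinate_def)
  qed
qed

text \<open>
  The forward and the backward finite predictors share their coefficients, and symmetry of the scalar
  second moments gives them equal mean square errors; the residual variances are the limits of these.
\<close>

lemma (in prob_space) AR_residual_var_time_reversed:
  fixes Z :: "int \<Rightarrow> 'a \<Rightarrow> real ^ 'n"
  assumes st: "stationary M Z"
    and fwd: "AR_representation M a (coordinate i Z) \<xi>"
    and bwd: "AR_representation M a (time_reversed (coordinate i Z)) (time_reversed \<xi>')"
  shows "residual_var M \<xi>' = residual_var M \<xi>"
proof -
  have sq: "square_integrable M (Z t)" for t
    using st by (simp add: stationary_def)
  let ?X = "coordinate i Z"
  have X: "?X t \<in> L2 M" for t
    using square_integrable_component[OF sq] by (simp add: coordinate_def[abs_def])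
  have shift: "moment M (?X (s + h)) (?X (t + h)) = moment M (?X s) (?X t)" for s t h
    using stationary_moment_shift[OF st] by (simp add: observation_Pair coordinate_def[abs_def])
  have reflect: "moment M (?X (- s)) (?X (- t)) = moment M (?X s) (?X t)" for s t
    using shift[of "- s" "s + t" "- t"] by (simp add: moment_commute[of M "?X s"])
  define u v where "u k = ?X (- int k)" and "v k = ?X (int k)" for k
  have uv: "moment M (u j) (u k) = moment M (v j) (v k)" for j k
    by (simp add: u_def v_def reflect)
  have L: "u k \<in> L2 M" "v k \<in> L2 M" for k
    by (simp_all add: u_def v_def X)
  have "expectation (\<lambda>\<omega>. (u 0 \<omega> - (\<Sum>k=1..n. a k * u k \<omega>))\<^sup>2)
      = expectation (\<lambda>\<omega>. (v 0 \<omega> - (\<Sum>k=1..n. a k * v k \<omega>))\<^sup>2)" for n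
    using mean_square_error_expand[where v = u and i = 0 and S = "{1..n}" and c = a]
      mean_square_error_expand[where v = v and i = 0 and S = "{1..n}" and c = a]
    by (simp add: L uv)
  then have eq: "(\<lambda>n. expectation (\<lambda>\<omega>. (?X 0 \<omega> - (\<Sum>k=1..n. a k * ?X (- int k) \<omega>))\<^sup>2))
      = (\<lambda>n. expectation (\<lambda>\<omega>. (?X 0 \<omega> - (\<Sum>k=1..n. a k * ?X (int k) \<omega>))\<^sup>2))"
    by (simp add: u_def v_def)
  have bwd_lim: "(\<lambda>n. expectation (\<lambda>\<omega>. (?X 0 \<omega> - (\<Sum>k=1..n. a k * ?X (int k) \<omega>))\<^sup>2))
      \<longlonglongrightarrow> residual_var M (time_reversed \<xi>')"
    using AR_mean_square_error_tendsto[OF bwd] X by (simp add: time_reversed_def)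
  have "residual_var M (time_reversed \<xi>') = residual_var M \<xi>"
    by (rule LIMSEQ_unique[OF bwd_lim AR_mean_square_error_tendsto[OF fwd X, unfolded eq]])
  then show ?thesis
    by (simp add: residual_var_def time_reversed_def)
qed

text \<open>
  If row \<open>i\<close> of every coefficient matrix involves coordinate \<open>i\<close> only, that row of the recursion is a
  univariate predictor with error \<open>\<epsilon> t $ i\<close>, and the univariate residual is at least as good.
\<close>

lemma (in prob_space) residual_var_le_residual_cov:
  fixes Z :: "int \<Rightarrow> 'a \<Rightarrow> real ^ 'n"
  assumes VAR: "VAR_representation M p A Z \<epsilon>" and sq: "\<And>t. square_integrable M (Z t)"
    and AR: "AR_representation M a (coordinate i Z) \<xi>"
    and diag: "\<And>k j. k \<in> {1..p} \<Longrightarrow> j \<noteq> i \<Longrightarrow> A k $ i $ j = 0"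
  shows "residual_var M \<xi> \<le> residual_cov M \<epsilon> $ i $ i"
proof -
  let ?X = "coordinate i Z"
  let ?e = "\<lambda>\<omega>. ?X 0 \<omega> - (\<Sum>k=1..p. A k $ i $ i * ?X (- int k) \<omega>)"
  have noise: "white_noise M \<epsilon>"
    using VAR by (simp add: VAR_representation_def)
  have X: "?X t \<in> L2 M" for t
    using square_integrable_component[OF sq] by (simp add: coordinate_def[abs_def])
  have "square_integrable M (\<epsilon> 0)"
    using noise by (simp add: white_noise_def stationary_def)
  then have eL: "(\<lambda>\<omega>. \<epsilon> 0 \<omega> $ i) \<in> L2 M"
    by (rule square_integrable_component)
  have "AE \<omega> in M. Z 0 \<omega> = (\<Sum>k=1..p. A k *v Z (0 - int k) \<omega>) + \<epsilon> 0 \<omega>"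
    using VAR unfolding VAR_representation_def by blast
  then have ae: "AE \<omega> in M. ?e \<omega> = \<epsilon> 0 \<omega> $ i"
  proof eventually_elim
    case (elim \<omega>)
    have "(A k *v Z (- int k) \<omega>) $ i = A k $ i $ i * ?X (- int k) \<omega>" if "k \<in> {1..p}" for k
    proof -
      have "(A k *v Z (- int k) \<omega>) $ i
          = (\<Sum>j\<in>UNIV. if j = i then A k $ i $ i * Z (- int k) \<omega> $ i else 0)"
        unfolding matrix_vector_mult_def vec_lambda_beta using diag[OF that]
        by (intro sum.cong) auto
      then show ?thesis by (simp add: coordinate_def)
    qed
    then have "(\<Sum>k=1..p. A k *v Z (- int k) \<omega>) $ i = (\<Sum>k=1..p. A k $ i $ i * ?X (- int k) \<omega>)"
      by simp
    then show ?case
      using arg_cong[OF elim, of "\<lambda>x. x $ i"] by (simp add: coordinate_def)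
  qed
  have optimal: "\<forall>t n c. expectation (\<lambda>\<omega>. (\<xi> t \<omega>)\<^sup>2)
      \<le> expectation (\<lambda>\<omega>. (?X t \<omega> - (\<Sum>k=1..n. c k * ?X (t - int k) \<omega>))\<^sup>2)"
    using AR unfolding AR_representation_def by blast
  have "expectation (\<lambda>\<omega>. (\<xi> 0 \<omega>)\<^sup>2)
      \<le> expectation (\<lambda>\<omega>. (?X 0 \<omega> - (\<Sum>k=1..p. A k $ i $ i * ?X (0 - int k) \<omega>))\<^sup>2)"
    by (rule optimal[THEN spec, of 0, THEN spec, of p, THEN spec, of "\<lambda>k. A k $ i $ i"])
  also have "\<dots> = moment M (\<lambda>\<omega>. \<epsilon> 0 \<omega> $ i) (\<lambda>\<omega>. \<epsilon> 0 \<omega> $ i)"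
    using ae eL L2_diff[OF X L2_sum[of "{1..p}" "\<lambda>k. ?X (- int k)", OF X]]
    by (simp flip: moment_self) (intro moment_cong_AE)
  finally show ?thesis
    by (simp add: AR_residual_var(1)[OF AR] white_noise_moment[OF noise])
qed

section \<open>Granger scores under time reversal\<close>

lemma residual_cov_Hadamard:
  fixes \<epsilon> :: "int \<Rightarrow> 'a \<Rightarrow> real ^ 2"
  shows "det (residual_cov M \<epsilon>) \<le> residual_cov M \<epsilon> $ 1 $ 1 * residual_cov M \<epsilon> $ 2 $ 2"
proof -
  have "residual_cov M \<epsilon> $ 2 $ 1 = residual_cov M \<epsilon> $ 1 $ 2"
    by (simp add: residual_cov_def cross_moment_nth moment_commute)
  then show ?thesis
    by (simp add: det_2)
qed

theorem corollary1:
  fixes M :: "'a measure"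
    and p :: nat
    and A A' :: "nat \<Rightarrow> real ^ 2 ^ 2"
    and z \<epsilon> \<epsilon>' :: "int \<Rightarrow> 'a \<Rightarrow> real ^ 2"
    and a b :: "nat \<Rightarrow> real"
    and \<xi>x \<xi>y \<xi>x' \<xi>y' :: "int \<Rightarrow> 'a \<Rightarrow> real"
  assumes "prob_space M"
    and "p \<ge> 1"
    and "stable_VAR p A"
    and "stationary M z"
    and "VAR_representation M p A z \<epsilon>"
    and "VAR_representation M p A' (time_reversed z) (time_reversed \<epsilon>')"
    and "AR_representation M a (coordinate 1 z) \<xi>x"
    and "AR_representation M b (coordinate 2 z) \<xi>y"
    and "AR_representation M a (time_reversed (coordinate 1 z)) (time_reversed \<xi>x')"
    and "AR_representation M b (time_reversed (coordinate 2 z)) (time_reversed \<xi>y')"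
    and "residual_cov M \<epsilon> $ 1 $ 1 > 0"
    and "residual_cov M \<epsilon> $ 2 $ 2 > 0"
    and A1: "\<And>k. k \<in> {1..p} \<Longrightarrow> lower_triangular2 (A k)"
    and A2: "diagonal_matrix (residual_cov M \<epsilon>)"
    and A3: "invertible (autocov M z 0)"
  shows
    "let F_yx  = granger_score (residual_var M \<xi>x) (residual_cov M \<epsilon> $ 1 $ 1);
         F_xy  = granger_score (residual_var M \<xi>y) (residual_cov M \<epsilon> $ 2 $ 2);
         F_yx' = granger_score (residual_var M \<xi>x') (residual_cov M \<epsilon>' $ 1 $ 1);
         F_xy' = granger_score (residual_var M \<xi>y') (residual_cov M \<epsilon>' $ 2 $ 2);
         D_yx  = F_yx - F_yx';
         D_xy  = F_xy - F_xy';
         D_net_xy = (F_xy - F_yx) - (F_xy' - F_yx')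
     in D_yx \<le> 0 \<and> D_xy \<ge> 0 \<and> D_net_xy \<ge> 0"
proof -
  interpret prob_space M by fact
  note st = \<open>stationary M z\<close>
  note fwd = \<open>VAR_representation M p A z \<epsilon>\<close>
  note bwd = \<open>VAR_representation M p A' (time_reversed z) (time_reversed \<epsilon>')\<close>
  note ARx = \<open>AR_representation M a (coordinate 1 z) \<xi>x\<close>
  note ARy = \<open>AR_representation M b (coordinate 2 z) \<xi>y\<close>
  note ARx' = \<open>AR_representation M a (time_reversed (coordinate 1 z)) (time_reversed \<xi>x')\<close>
  note ARy' = \<open>AR_representation M b (time_reversed (coordinate 2 z)) (time_reversed \<xi>y')\<close>
  define Sxx Syy where "Sxx = residual_cov M \<epsilon> $ 1 $ 1" and "Syy = residual_cov M \<epsilon> $ 2 $ 2"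
  define Sxx' Syy' where "Sxx' = residual_cov M \<epsilon>' $ 1 $ 1" and "Syy' = residual_cov M \<epsilon>' $ 2 $ 2"
  define Sx Sy where "Sx = residual_var M \<xi>x" and "Sy = residual_var M \<xi>y"
  have pos: "0 < Sxx" "0 < Syy"
    using assms(11,12) by (simp_all add: Sxx_def Syy_def)
  have sq: "square_integrable M (z t)" "square_integrable M (time_reversed z t)" for t
    using st by (simp_all add: stationary_def time_reversed_def)
  have rev: "residual_var M \<xi>x' = Sx" "residual_var M \<xi>y' = Sy"
    unfolding Sx_def Sy_def
    using AR_residual_var_time_reversed[OF st ARx ARx'] AR_residual_var_time_reversed[OF st ARy ARy']
    by simp_all
  have "Sxx \<le> Sx" "Syy \<le> Sy"
    unfolding Sxx_def Sx_def Syy_def Sy_def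
    using residual_cov_le_residual_var[OF fwd sq(1)] ARx ARy by blast+
  with pos have posS: "0 < Sx" "0 < Sy"
    by simp_all
  have Sx_le: "Sx \<le> Sxx"
    unfolding Sx_def Sxx_def
  proof (rule residual_var_le_residual_cov[OF fwd sq(1) ARx])
    fix k :: nat and j :: 2
    assume "k \<in> {1..p}" "j \<noteq> 1"
    then show "A k $ 1 $ j = 0"
      using A1[of k] exhaust_2[of j] by (auto simp: lower_triangular2_def)
  qed
  have commute: "coordinate 1 (time_reversed z) = time_reversed (coordinate 1 z)"
    by (intro ext) (simp add: coordinate_def time_reversed_def)
  have "residual_cov M (time_reversed \<epsilon>') $ 1 $ 1 \<le> residual_var M (time_reversed \<xi>x')"
    by (rule residual_cov_le_residual_var[OF bwd sq(2), of a]) (simp only: commute ARx')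
  then have "Sxx' \<le> Sx"
    using rev by (simp add: Sxx'_def residual_cov_def residual_var_def time_reversed_def)
  then have xx: "Sxx' \<le> Sxx"
    using Sx_le by simp
  have det: "det (residual_cov M \<epsilon>) = Sxx * Syy"
    using A2 by (simp add: det_2 diagonal_matrix_def Sxx_def Syy_def)
  then have prod: "Sxx * Syy \<le> Sxx' * Syy'"
    using det_residual_cov_time_reversed[OF st fwd bwd] pos residual_cov_Hadamard[of M \<epsilon>']
    by (simp add: Sxx'_def Syy'_def)
  have "0 \<le> Sxx'" "0 \<le> Syy'"
    by (simp_all add: Sxx'_def Syy'_def residual_cov_def cross_moment_nth moment_self_nonneg)
  moreover have "0 < Sxx' * Syy'"
    using prod mult_pos_pos[OF pos] by linarith
  ultimately have pos': "0 < Sxx'" "0 < Syy'"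
    by (auto simp: zero_less_mult_iff)
  have "Sxx * Syy \<le> Sxx * Syy'"
    using prod mult_right_mono[OF xx, of Syy'] pos' by linarith
  then have yy: "Syy \<le> Syy'"
    using pos by simp
  have lns: "ln Sxx' \<le> ln Sxx" "ln Syy \<le> ln Syy'"
    using xx yy pos pos' by simp_all
  then show ?thesis
    unfolding Let_def granger_score_def rev
    unfolding Sx_def[symmetric] Sy_def[symmetric] Sxx_def[symmetric] Syy_def[symmetric]
      Sxx'_def[symmetric] Syy'_def[symmetric]
    using pos pos' posS by (simp add: ln_div) (use lns in linarith)
qed

end
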